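(* Let $N\in\mathbb N$. For the linear isomorphism $\ddag:P_N\to {\rm Fix}(G)$ sending $x^ry^sz^tw^u\mapsto (N!\,2^N)^{1/2}\,\tilde B(r,s,t,u)$ for all $(r,s,t,u)\in\mathcal P_N$, the Hermitian forms on $P_N$ and ${\rm Fix}(G)$ are related by $$\langle f,g\rangle=\langle f^\ddag,g^\ddag\rangle\qquad\text{for all } f,g\in P_N .$$
   Context: $\mathbb N=\{0,1,2,\ldots\}$; all vector spaces are over $\mathbb C$. A Hermitian form is $\mathbb C$-linear in the first argument and satisfies $\langle f,g\rangle=\overline{\langle g,f\rangle}$. Polynomials: $P=\mathbb C[x,y,z,w]$ (commuting indeterminates), $P_N$ is the subspace of homogeneous polynomials of total degree $N$, and $\mathcal P_N$ is the set of $(r,s,t,u)\in\mathbb N^4$ with $r+s+t+u=N$. The monomials $x^ry^sz^tw^u$ with $(r,s,t,u)\in\mathcal P_N$ form a basis of $P_N$. $P$ carries the Hermitian form for which the monomials $x^ry^sz^tw^u$ ($r,s,t,u\in\mathbb N$) are mutually orthogonal with $\langle x^ry^sz^tw^u,x^ry^sz^tw^u\rangle=r!s!t!u!$. Hypercube: $H(N,2)$ is the graph with vertex set $X=\{1,-1\}^N$, two vertices being adjacent when they differ in exactly one coordinate. $V$ is the vector space with basis $X$; $V^{\otimes 3}=V\otimes V\otimes V$ has basis $X^{\otimes 3}=\{x\otimes y\otimes z: x,y,z\in X\}$ and carries the Hermitian form for which $X^{\otimes 3}$ is orthonormal. $G$ is the automorphism group of the graph $H(N,2)$; it acts linearly on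 $V$ by permuting $X$ and on $V^{\otimes 3}$ by $g(u\otimes v\otimes w)=g(u)\otimes g(v)\otimes g(w)$. ${\rm Fix}(G)=\{v\in V^{\otimes 3}: g(v)=v\ \forall g\in G\}$, with the form restricted from $V^{\otimes 3}$. The profile of $x\otimes y\otimes z\in X^{\otimes 3}$ is $(r,s,t,u)\in\mathcal P_N$, where $r=|\{i:x_i=y_i=z_i\}|$, $s=|\{i:x_i\ne y_i=z_i\}|$, $t=|\{i:y_i\neq z_i=x_i\}|$, $u=|\{i:z_i\ne x_i=y_i\}|$. For $(r,s,t,u)\in\mathcal P_N$, $B(r,s,t,u)$ is the sum of all elements of $X^{\otimes 3}$ with profile $(r,s,t,u)$, and $\tilde B(r,s,t,u)=\frac{r!s!t!u!}{N!\,2^N}B(r,s,t,u)$. The vectors $\tilde B(r,s,t,u)$, $(r,s,t,u)\in\mathcal P_N$, form a basis of ${\rm Fix}(G)$, so $\ddag$ is a well-defined vector space isomorphism. *)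

theory Defs
  imports Complex_Main "HOL-Library.Poly_Mapping" "HOL-Library.Product_Plus"
    "HOL-Library.FuncSet" "HOL-Algebra.Bij"
begin

section \<open>Finitely supported complex functions as vector spaces\<close>

text \<open>The type \<open>'a \<Rightarrow>\<^sub>0 complex\<close> is the complex vector space with basis the elements of \<open>'a\<close>;
  the basis vector belonging to \<open>a\<close> is \<open>Poly_Mapping.single a 1\<close>.\<close>

definition scale :: "complex \<Rightarrow> ('a \<Rightarrow>\<^sub>0 complex) \<Rightarrow> ('a \<Rightarrow>\<^sub>0 complex)" where
  "scale c v = Poly_Mapping.map ((*) c) v"

definition linear_iso ::
  "('a \<Rightarrow>\<^sub>0 complex) set \<Rightarrow> ('b \<Rightarrow>\<^sub>0 complex) set \<Rightarrow> (('a \<Rightarrow>\<^sub>0 complex) \<Rightarrow> ('b \<Rightarrow>\<^sub>0 complex)) \<Rightarrow> bool" where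
  "linear_iso S T F \<longleftrightarrow>
     (\<forall>u\<in>S. \<forall>v\<in>S. F (u + v) = F u + F v) \<and>
     (\<forall>c. \<forall>v\<in>S. F (scale c v) = scale c (F v)) \<and>
     bij_betw F S T"

lemma lookup_scale [simp]: "Poly_Mapping.lookup (scale c v) k = c * Poly_Mapping.lookup v k"
  unfolding scale_def by (simp add: Poly_Mapping.map.rep_eq when_def)

lemma vector_space_scale: "vector_space scale"
  by unfold_locales
    (auto intro!: poly_mapping_eqI simp: Poly_Mapping.lookup_add algebra_simps)


section \<open>The polynomial algebra in four indeterminates\<close>

text \<open>The monoid algebra of \<open>\<nat>\<^sup>4\<close> over the complex numbers; multiplication is the convolution
  product provided by \<open>Poly_Mapping\<close>.\<close>

type_synonym exponent = "nat \<times> nat \<times> nat \<times> nat"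
type_synonym poly4 = "exponent \<Rightarrow>\<^sub>0 complex"

definition ind_x :: poly4 where "ind_x = Poly_Mapping.single (1, 0, 0, 0) 1"
definition ind_y :: poly4 where "ind_y = Poly_Mapping.single (0, 1, 0, 0) 1"
definition ind_z :: poly4 where "ind_z = Poly_Mapping.single (0, 0, 1, 0) 1"
definition ind_w :: poly4 where "ind_w = Poly_Mapping.single (0, 0, 0, 1) 1"

definition monom4 :: "exponent \<Rightarrow> poly4" where
  "monom4 = (\<lambda>(r, s, t, u). ind_x ^ r * ind_y ^ s * ind_z ^ t * ind_w ^ u)"

definition exps :: "nat \<Rightarrow> exponent set" where
  "exps N = {(r, s, t, u). r + s + t + u = N}"

definition homog :: "nat \<Rightarrow> poly4 set" where
  "homog N = {f. Poly_Mapping.keys f \<subseteq> exps N}"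

definition fact4 :: "exponent \<Rightarrow> complex" where
  "fact4 = (\<lambda>(r, s, t, u). fact r * fact s * fact t * fact u)"

definition poly_form :: "poly4 \<Rightarrow> poly4 \<Rightarrow> complex" where
  "poly_form f g = (\<Sum>m\<in>Poly_Mapping.keys f.
     fact4 m * Poly_Mapping.lookup f m * cnj (Poly_Mapping.lookup g m))"


section \<open>The hypercube and the triple tensor power of its standard module\<close>

type_synonym vertex = "nat \<Rightarrow> int"

text \<open>A vertex has coordinates indexed by \<open>{..<N}\<close>, with the value \<open>undefined\<close> elsewhere.\<close>

definition cube :: "nat \<Rightarrow> vertex set" where
  "cube N = {..<N} \<rightarrow>\<^sub>E {1, - 1}"

definition cube_adj :: "nat \<Rightarrow> vertex \<Rightarrow> vertex \<Rightarrow> bool" where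
  "cube_adj N x y \<longleftrightarrow> card {i. i < N \<and> x i \<noteq> y i} = 1"

definition cube_aut :: "nat \<Rightarrow> (vertex \<Rightarrow> vertex) set" where
  "cube_aut N = {g \<in> Bij (cube N).
     \<forall>x\<in>cube N. \<forall>y\<in>cube N. cube_adj N (g x) (g y) \<longleftrightarrow> cube_adj N x y}"

definition cubeV :: "nat \<Rightarrow> (vertex \<Rightarrow>\<^sub>0 complex) set" where
  "cubeV N = {v. Poly_Mapping.keys v \<subseteq> cube N}"

text \<open>\<open>V \<otimes> V \<otimes> V\<close> is realised as the space with basis \<open>X \<times> X \<times> X\<close>, the triple \<open>(x, y, z)\<close> standing
  for the pure tensor \<open>x \<otimes> y \<otimes> z\<close>.\<close>

definition tensor3 ::
  "('a \<Rightarrow>\<^sub>0 complex) \<Rightarrow> ('a \<Rightarrow>\<^sub>0 complex) \<Rightarrow> ('a \<Rightarrow>\<^sub>0 complex) \<Rightarrow> ('a \<times> 'a \<times> 'a \<Rightarrow>\<^sub>0 complex)" where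
  "tensor3 u v w = (\<Sum>x\<in>Poly_Mapping.keys u. \<Sum>y\<in>Poly_Mapping.keys v. \<Sum>z\<in>Poly_Mapping.keys w.
     Poly_Mapping.single (x, y, z)
       (Poly_Mapping.lookup u x * Poly_Mapping.lookup v y * Poly_Mapping.lookup w z))"

definition cubeV3 :: "nat \<Rightarrow> (vertex \<times> vertex \<times> vertex \<Rightarrow>\<^sub>0 complex) set" where
  "cubeV3 N = {v. Poly_Mapping.keys v \<subseteq> cube N \<times> cube N \<times> cube N}"

definition tensor_form :: "('b \<Rightarrow>\<^sub>0 complex) \<Rightarrow> ('b \<Rightarrow>\<^sub>0 complex) \<Rightarrow> complex" where
  "tensor_form v w = (\<Sum>k\<in>Poly_Mapping.keys v.
     Poly_Mapping.lookup v k * cnj (Poly_Mapping.lookup w k))"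

definition act :: "('a \<Rightarrow> 'a) \<Rightarrow> ('a \<Rightarrow>\<^sub>0 complex) \<Rightarrow> ('a \<Rightarrow>\<^sub>0 complex)" where
  "act g v = (\<Sum>x\<in>Poly_Mapping.keys v. Poly_Mapping.single (g x) (Poly_Mapping.lookup v x))"

text \<open>The linear extension of \<open>x \<otimes> y \<otimes> z \<mapsto> g x \<otimes> g y \<otimes> g z\<close>; see \<open>act3_tensor3\<close> for general pure
  tensors.\<close>

definition act3 :: "('a \<Rightarrow> 'a) \<Rightarrow> ('a \<times> 'a \<times> 'a \<Rightarrow>\<^sub>0 complex) \<Rightarrow> ('a \<times> 'a \<times> 'a \<Rightarrow>\<^sub>0 complex)" where
  "act3 g v = act (\<lambda>(x, y, z). (g x, g y, g z)) v"

definition fixG :: "nat \<Rightarrow> (vertex \<times> vertex \<times> vertex \<Rightarrow>\<^sub>0 complex) set" where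
  "fixG N = {v \<in> cubeV3 N. \<forall>g\<in>cube_aut N. act3 g v = v}"

definition profile :: "nat \<Rightarrow> vertex \<times> vertex \<times> vertex \<Rightarrow> exponent" where
  "profile N = (\<lambda>(x, y, z).
     (card {i. i < N \<and> x i = y i \<and> y i = z i},
      card {i. i < N \<and> x i \<noteq> y i \<and> y i = z i},
      card {i. i < N \<and> y i \<noteq> z i \<and> z i = x i},
      card {i. i < N \<and> z i \<noteq> x i \<and> x i = y i}))"

definition Bvec :: "nat \<Rightarrow> exponent \<Rightarrow> (vertex \<times> vertex \<times> vertex \<Rightarrow>\<^sub>0 complex)" where
  "Bvec N m = (\<Sum>(x, y, z) \<in> {k \<in> cube N \<times> cube N \<times> cube N. profile N k = m}.
     tensor3 (Poly_Mapping.single x 1) (Poly_Mapping.single y 1) (Poly_Mapping.single z 1))"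

definition Btilde :: "nat \<Rightarrow> exponent \<Rightarrow> (vertex \<times> vertex \<times> vertex \<Rightarrow>\<^sub>0 complex)" where
  "Btilde N m = scale (fact4 m / (fact N * 2 ^ N)) (Bvec N m)"


section \<open>Characteristic properties of the definitions\<close>

lemma single_power_exponent:
  fixes a :: exponent
  shows "Poly_Mapping.single a (1::complex) ^ n = Poly_Mapping.single (((+) a ^^ n) 0) 1"
  by (induction n) (simp_all add: mult_single)

lemma monom4_eq_single: "monom4 m = Poly_Mapping.single m 1"
proof -
  obtain r s t u where m: "m = (r, s, t, u)" by (cases m)
  have 1: "((+) (1::nat, 0::nat, 0::nat, 0::nat) ^^ n) 0 = (n, 0, 0, 0)" for n
    by (induction n) (simp_all add: zero_prod_def)
  have 2: "((+) (0::nat, 1::nat, 0::nat, 0::nat) ^^ n) 0 = (0, n, 0, 0)" for n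
    by (induction n) (simp_all add: zero_prod_def)
  have 3: "((+) (0::nat, 0::nat, 1::nat, 0::nat) ^^ n) 0 = (0, 0, n, 0)" for n
    by (induction n) (simp_all add: zero_prod_def)
  have 4: "((+) (0::nat, 0::nat, 0::nat, 1::nat) ^^ n) 0 = (0, 0, 0, n)" for n
    by (induction n) (simp_all add: zero_prod_def)
  show ?thesis
    unfolding m monom4_def ind_x_def ind_y_def ind_z_def ind_w_def
    by (simp only: prod.case single_power_exponent 1 2 3 4 mult_single) simp
qed

lemma sum_keys_superset:
  assumes "finite A" "Poly_Mapping.keys f \<subseteq> A" "\<And>k. Poly_Mapping.lookup f k = 0 \<Longrightarrow> h k = 0"
  shows "(\<Sum>k\<in>Poly_Mapping.keys f. h k) = sum h A"
  using assms by (intro sum.mono_neutral_left) (auto simp: Poly_Mapping.in_keys_iff)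

lemma poly_form_monom4:
  "poly_form (monom4 m) (monom4 m') = (if m = m' then fact4 m else 0)"
  by (simp add: poly_form_def monom4_eq_single Poly_Mapping.lookup_single when_def)

lemma poly_form_add_left: "poly_form (f + g) h = poly_form f h + poly_form g h"
proof -
  let ?A = "Poly_Mapping.keys f \<union> Poly_Mapping.keys g"
  have "poly_form p h = (\<Sum>m\<in>?A. fact4 m * Poly_Mapping.lookup p m * cnj (Poly_Mapping.lookup h m))"
    if "Poly_Mapping.keys p \<subseteq> ?A" for p
    unfolding poly_form_def by (rule sum_keys_superset) (use that in auto)
  from this[of f] this[of g] this[of "f + g"] show ?thesis
    using Poly_Mapping.keys_add[of f g]
    by (simp add: Poly_Mapping.lookup_add sum.distrib algebra_simps)
qed

lemma poly_form_scale_left: "poly_form (scale c f) g = c * poly_form f g"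
proof -
  have "Poly_Mapping.keys (scale c f) \<subseteq> Poly_Mapping.keys f"
    by (auto simp: Poly_Mapping.in_keys_iff)
  then have "poly_form (scale c f) g = (\<Sum>m\<in>Poly_Mapping.keys f.
     fact4 m * Poly_Mapping.lookup (scale c f) m * cnj (Poly_Mapping.lookup g m))"
    unfolding poly_form_def by (intro sum_keys_superset) auto
  then show ?thesis
    by (simp add: poly_form_def sum_distrib_left algebra_simps)
qed

lemma poly_form_hermitian: "poly_form f g = cnj (poly_form g f)"
proof -
  let ?A = "Poly_Mapping.keys f \<union> Poly_Mapping.keys g"
  have 1: "poly_form f g = (\<Sum>m\<in>?A. fact4 m * Poly_Mapping.lookup f m * cnj (Poly_Mapping.lookup g m))"
    unfolding poly_form_def by (rule sum_keys_superset) auto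
  have 2: "poly_form g f = (\<Sum>m\<in>?A. fact4 m * Poly_Mapping.lookup g m * cnj (Poly_Mapping.lookup f m))"
    unfolding poly_form_def by (rule sum_keys_superset) auto
  have "cnj (fact4 m) = fact4 m" for m
    by (cases m) (simp add: fact4_def)
  then show ?thesis
    unfolding 1 2 by (simp add: mult_ac)
qed

lemma tensor_form_single:
  "tensor_form (Poly_Mapping.single k 1) (Poly_Mapping.single k' 1) = (if k = k' then 1 else 0)"
  by (simp add: tensor_form_def Poly_Mapping.lookup_single when_def)

lemma tensor_form_add_left: "tensor_form (f + g) h = tensor_form f h + tensor_form g h"
proof -
  let ?A = "Poly_Mapping.keys f \<union> Poly_Mapping.keys g"
  have "tensor_form p h = (\<Sum>m\<in>?A. Poly_Mapping.lookup p m * cnj (Poly_Mapping.lookup h m))"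
    if "Poly_Mapping.keys p \<subseteq> ?A" for p
    unfolding tensor_form_def by (rule sum_keys_superset) (use that in auto)
  from this[of f] this[of g] this[of "f + g"] show ?thesis
    using Poly_Mapping.keys_add[of f g]
    by (simp add: Poly_Mapping.lookup_add sum.distrib algebra_simps)
qed

lemma tensor_form_scale_left: "tensor_form (scale c f) g = c * tensor_form f g"
proof -
  have "Poly_Mapping.keys (scale c f) \<subseteq> Poly_Mapping.keys f"
    by (auto simp: Poly_Mapping.in_keys_iff)
  then have "tensor_form (scale c f) g = (\<Sum>m\<in>Poly_Mapping.keys f.
     Poly_Mapping.lookup (scale c f) m * cnj (Poly_Mapping.lookup g m))"
    unfolding tensor_form_def by (intro sum_keys_superset) auto
  then show ?thesis
    by (simp add: tensor_form_def sum_distrib_left algebra_simps)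
qed

lemma tensor_form_hermitian: "tensor_form f g = cnj (tensor_form g f)"
proof -
  let ?A = "Poly_Mapping.keys f \<union> Poly_Mapping.keys g"
  have 1: "tensor_form f g = (\<Sum>m\<in>?A. Poly_Mapping.lookup f m * cnj (Poly_Mapping.lookup g m))"
    unfolding tensor_form_def by (rule sum_keys_superset) auto
  have 2: "tensor_form g f = (\<Sum>m\<in>?A. Poly_Mapping.lookup g m * cnj (Poly_Mapping.lookup f m))"
    unfolding tensor_form_def by (rule sum_keys_superset) auto
  show ?thesis
    unfolding 1 2 by (simp add: mult_ac)
qed

lemma lookup_tensor3:
  "Poly_Mapping.lookup (tensor3 u v w) (x, y, z) =
     Poly_Mapping.lookup u x * Poly_Mapping.lookup v y * Poly_Mapping.lookup w z"
proof -
  have eq: "Poly_Mapping.lookup (tensor3 u v w) (x, y, z) =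
    (\<Sum>a\<in>Poly_Mapping.keys u. \<Sum>b\<in>Poly_Mapping.keys v. \<Sum>c\<in>Poly_Mapping.keys w.
       (if a = x then if b = y then if c = z then
          Poly_Mapping.lookup u a * Poly_Mapping.lookup v b * Poly_Mapping.lookup w c
        else 0 else 0 else 0))"
    unfolding tensor3_def Poly_Mapping.lookup_sum
    by (intro sum.cong refl) (simp add: Poly_Mapping.lookup_single when_def)
  have "(\<Sum>c\<in>Poly_Mapping.keys w. if a = x then if b = y then if c = z then
          Poly_Mapping.lookup u a * Poly_Mapping.lookup v b * Poly_Mapping.lookup w c
        else 0 else 0 else 0) =
      (if a = x then if b = y then
          Poly_Mapping.lookup u a * Poly_Mapping.lookup v b * Poly_Mapping.lookup w z else 0 else 0)" for a b
    by (auto simp: sum.delta Poly_Mapping.in_keys_iff)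
  moreover have "(\<Sum>b\<in>Poly_Mapping.keys v. if a = x then if b = y then
          Poly_Mapping.lookup u a * Poly_Mapping.lookup v b * Poly_Mapping.lookup w z else 0 else 0) =
       (if a = x then
          Poly_Mapping.lookup u a * Poly_Mapping.lookup v y * Poly_Mapping.lookup w z else 0)" for a
    by (auto simp: sum.delta Poly_Mapping.in_keys_iff)
  ultimately show ?thesis
    unfolding eq by (auto simp: sum.delta Poly_Mapping.in_keys_iff)
qed

lemma tensor3_single:
  "tensor3 (Poly_Mapping.single x 1) (Poly_Mapping.single y 1) (Poly_Mapping.single z 1) =
     Poly_Mapping.single (x, y, z) 1"
  by (rule poly_mapping_eqI)
    (auto simp: lookup_tensor3 Poly_Mapping.lookup_single when_def split: if_splits)

lemma act_single: "act g (Poly_Mapping.single a c) = Poly_Mapping.single (g a) c"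
  by (cases "c = 0") (simp_all add: act_def)

lemma act_superset:
  assumes "finite A" "Poly_Mapping.keys v \<subseteq> A"
  shows "act g v = (\<Sum>x\<in>A. Poly_Mapping.single (g x) (Poly_Mapping.lookup v x))"
  unfolding act_def by (rule sum_keys_superset) (use assms in auto)

lemma act_add: "act g (v + w) = act g v + act g w"
proof -
  let ?A = "Poly_Mapping.keys v \<union> Poly_Mapping.keys w"
  show ?thesis
    using Poly_Mapping.keys_add[of v w]
    by (simp add: act_superset[of ?A] Poly_Mapping.lookup_add Poly_Mapping.single_add sum.distrib)
qed

lemma act_sum: "act g (\<Sum>i\<in>I. f i) = (\<Sum>i\<in>I. act g (f i))"
  by (induction I rule: infinite_finite_induct) (simp_all add: act_add, simp_all add: act_def)

lemma act_scale: "act g (scale c v) = scale c (act g v)"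
proof -
  have "Poly_Mapping.keys (scale c v) \<subseteq> Poly_Mapping.keys v"
    by (auto simp: Poly_Mapping.in_keys_iff)
  then show ?thesis
    by (intro poly_mapping_eqI)
      (simp add: act_superset[of "Poly_Mapping.keys v"] Poly_Mapping.lookup_sum
        Poly_Mapping.lookup_single when_def sum_distrib_left if_distrib cong: if_cong)
qed

lemma tensor3_superset:
  assumes "finite A" "finite B" "finite C"
    "Poly_Mapping.keys u \<subseteq> A" "Poly_Mapping.keys v \<subseteq> B" "Poly_Mapping.keys w \<subseteq> C"
  shows "tensor3 u v w = (\<Sum>x\<in>A. \<Sum>y\<in>B. \<Sum>z\<in>C. Poly_Mapping.single (x, y, z)
       (Poly_Mapping.lookup u x * Poly_Mapping.lookup v y * Poly_Mapping.lookup w z))"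
proof -
  have "(\<Sum>z\<in>Poly_Mapping.keys w. Poly_Mapping.single (x, y, z)
       (Poly_Mapping.lookup u x * Poly_Mapping.lookup v y * Poly_Mapping.lookup w z)) =
    (\<Sum>z\<in>C. Poly_Mapping.single (x, y, z)
       (Poly_Mapping.lookup u x * Poly_Mapping.lookup v y * Poly_Mapping.lookup w z))" for x y
    by (rule sum_keys_superset) (use assms in auto)
  moreover have "(\<Sum>y\<in>Poly_Mapping.keys v. \<Sum>z\<in>C. Poly_Mapping.single (x, y, z)
       (Poly_Mapping.lookup u x * Poly_Mapping.lookup v y * Poly_Mapping.lookup w z)) =
    (\<Sum>y\<in>B. \<Sum>z\<in>C. Poly_Mapping.single (x, y, z)
       (Poly_Mapping.lookup u x * Poly_Mapping.lookup v y * Poly_Mapping.lookup w z))" for x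
    by (rule sum_keys_superset) (use assms in auto)
  ultimately have "tensor3 u v w = (\<Sum>x\<in>Poly_Mapping.keys u. \<Sum>y\<in>B. \<Sum>z\<in>C. Poly_Mapping.single (x, y, z)
       (Poly_Mapping.lookup u x * Poly_Mapping.lookup v y * Poly_Mapping.lookup w z))"
    unfolding tensor3_def by simp
  also have "\<dots> = (\<Sum>x\<in>A. \<Sum>y\<in>B. \<Sum>z\<in>C. Poly_Mapping.single (x, y, z)
       (Poly_Mapping.lookup u x * Poly_Mapping.lookup v y * Poly_Mapping.lookup w z))"
    by (rule sum_keys_superset) (use assms in auto)
  finally show ?thesis .
qed

lemma lookup_act: "Poly_Mapping.lookup (act g v) k =
    (\<Sum>x\<in>Poly_Mapping.keys v. if g x = k then Poly_Mapping.lookup v x else 0)"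
  by (simp add: act_def Poly_Mapping.lookup_sum Poly_Mapping.lookup_single when_def)

lemma act3_tensor3: "act3 g (tensor3 u v w) = tensor3 (act g u) (act g v) (act g w)"
proof (rule poly_mapping_eqI)
  fix k :: "'a \<times> 'a \<times> 'a"
  obtain a b c where k: "k = (a, b, c)" by (cases k)
  have "Poly_Mapping.lookup (act3 g (tensor3 u v w)) k =
    (\<Sum>x\<in>Poly_Mapping.keys u. \<Sum>y\<in>Poly_Mapping.keys v. \<Sum>z\<in>Poly_Mapping.keys w.
      (if g x = a then Poly_Mapping.lookup u x else 0) *
      (if g y = b then Poly_Mapping.lookup v y else 0) *
      (if g z = c then Poly_Mapping.lookup w z else 0))"
    unfolding tensor3_def act3_def act_sum act_single Poly_Mapping.lookup_sum k
    by (intro sum.cong refl) (simp add: Poly_Mapping.lookup_single when_def)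
  also have "\<dots> = Poly_Mapping.lookup (tensor3 (act g u) (act g v) (act g w)) k"
    unfolding k lookup_tensor3 lookup_act
    by (simp only: mult.assoc sum_distrib_right) (simp only: sum_distrib_left)
  finally show "Poly_Mapping.lookup (act3 g (tensor3 u v w)) k =
    Poly_Mapping.lookup (tensor3 (act g u) (act g v) (act g w)) k" .
qed

lemma subspace_homog: "module.subspace scale (homog N)"
proof -
  interpret vector_space scale by (rule vector_space_scale)
  show ?thesis
    unfolding subspace_def homog_def
    by (auto simp: Poly_Mapping.in_keys_iff subset_iff Poly_Mapping.lookup_add) (metis add_0)
qed

lemma cubeV3_eq_span:
  "cubeV3 N = module.span scale {tensor3 u v w |u v w. u \<in> cubeV N \<and> v \<in> cubeV N \<and> w \<in> cubeV N}"
    (is "_ = module.span scale ?T")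
proof -
  interpret vector_space scale by (rule vector_space_scale)
  have sub: "subspace (cubeV3 N)"
    unfolding subspace_def cubeV3_def
    by (auto simp: Poly_Mapping.in_keys_iff subset_iff Poly_Mapping.lookup_add) (metis add_0)+
  have "?T \<subseteq> cubeV3 N"
    by (auto simp: cubeV3_def cubeV_def subset_iff Poly_Mapping.in_keys_iff lookup_tensor3)
  then have "span ?T \<subseteq> cubeV3 N" using sub by (rule span_minimal)
  moreover have "v \<in> span ?T" if v: "v \<in> cubeV3 N" for v
  proof -
    have "v = (\<Sum>k\<in>Poly_Mapping.keys v. scale (Poly_Mapping.lookup v k) (Poly_Mapping.single k 1))"
      by (rule poly_mapping_eqI)
        (simp add: Poly_Mapping.lookup_sum Poly_Mapping.lookup_single when_def if_distrib
          Poly_Mapping.in_keys_iff cong: if_cong)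
    moreover have "Poly_Mapping.single k 1 \<in> ?T" if k: "k \<in> Poly_Mapping.keys v" for k
    proof -
      obtain x y z where xyz: "k = (x, y, z)" by (cases k)
      then have "x \<in> cube N" "y \<in> cube N" "z \<in> cube N"
        using v k by (auto simp: cubeV3_def)
      then show ?thesis
        unfolding xyz mem_Collect_eq
        by (intro exI[of _ "Poly_Mapping.single x 1"] exI[of _ "Poly_Mapping.single y 1"]
          exI[of _ "Poly_Mapping.single z 1"]) (simp add: tensor3_single cubeV_def)
    qed
    ultimately show ?thesis by (metis (no_types, lifting) span_sum span_scale span_base)
  qed
  ultimately show ?thesis by blast
qed

lemma subspace_fixG: "module.subspace scale (fixG N)"
proof -
  interpret vector_space scale by (rule vector_space_scale)
  have "act g 0 = 0" for g :: "vertex \<times> vertex \<times> vertex \<Rightarrow> vertex \<times> vertex \<times> vertex"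
    by (simp add: act_def)
  then show ?thesis
    unfolding subspace_def fixG_def cubeV3_def act3_def
    by (auto simp: act_add act_scale subset_iff Poly_Mapping.in_keys_iff Poly_Mapping.lookup_add)
      (metis add_0)+
qed

lemma subgroup_cube_aut: "subgroup (cube_aut N) (BijGroup (cube N))"
proof -
  let ?X = "cube N"
  interpret group "BijGroup ?X" by (rule group_BijGroup)
  have inv: "inv\<^bsub>BijGroup ?X\<^esub> g = restrict (inv_into ?X g) ?X" if "g \<in> Bij ?X" for g
    using that by (intro inv_equality)
      (auto simp: BijGroup_def Bij_compose_restrict_eq restrict_inv_into_Bij)
  show ?thesis
  proof (rule subgroupI)
    show "cube_aut N \<subseteq> carrier (BijGroup ?X)" by (auto simp: cube_aut_def BijGroup_def)
    have "(\<lambda>x\<in>?X. x) \<in> cube_aut N" by (auto simp: cube_aut_def id_Bij)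
    then show "cube_aut N \<noteq> {}" by blast
  next
    fix g assume g: "g \<in> cube_aut N"
    then have gb: "g \<in> Bij ?X" by (simp add: cube_aut_def)
    have *: "inv_into ?X g x \<in> ?X" "g (inv_into ?X g x) = x" if "x \<in> ?X" for x
      using gb that by (auto simp: Bij_def bij_betw_def inv_into_into f_inv_into_f)
    show "inv\<^bsub>BijGroup ?X\<^esub> g \<in> cube_aut N"
      using g * by (auto simp: inv[OF gb] cube_aut_def restrict_inv_into_Bij) (metis *)+
  next
    fix g h assume g: "g \<in> cube_aut N" and h: "h \<in> cube_aut N"
    then have "g \<in> Bij ?X" "h \<in> Bij ?X" by (auto simp: cube_aut_def)
    moreover from this have "h x \<in> ?X" if "x \<in> ?X" for x
      using that by (auto simp: Bij_def bij_betw_def)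
    ultimately show "g \<otimes>\<^bsub>BijGroup ?X\<^esub> h \<in> cube_aut N"
      using g h by (auto simp: BijGroup_def cube_aut_def compose_Bij compose_eq)
  qed
qed


section \<open>Existence of the isomorphism\<close>

definition hdist :: "nat \<Rightarrow> vertex \<Rightarrow> vertex \<Rightarrow> nat" where
  "hdist N x y = card {i. i < N \<and> x i \<noteq> y i}"

lemma finite_cube: "finite (cube N)"
  by (simp add: cube_def finite_PiE)

lemma cube_val: "x \<in> cube N \<Longrightarrow> i < N \<Longrightarrow> x i = 1 \<or> x i = -1"
  by (auto simp: cube_def PiE_iff)

lemma cube_eqI:
  assumes "x \<in> cube N" "y \<in> cube N" "\<And>i. i < N \<Longrightarrow> x i = y i" shows "x = y"
  using assms unfolding cube_def by (intro PiE_ext) auto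

lemma hdist_triangle: "hdist N x z \<le> hdist N x y + hdist N y z"
proof -
  have "hdist N x z \<le> card ({i. i < N \<and> x i \<noteq> y i} \<union> {i. i < N \<and> y i \<noteq> z i})"
    unfolding hdist_def by (intro card_mono) auto
  also have "\<dots> \<le> hdist N x y + hdist N y z"
    unfolding hdist_def by (rule card_Un_le)
  finally show ?thesis .
qed

lemma cube_aut_hdist_le:
  assumes g: "\<And>x. x \<in> cube N \<Longrightarrow> g x \<in> cube N"
    "\<And>x y. x \<in> cube N \<Longrightarrow> y \<in> cube N \<Longrightarrow> cube_adj N x y \<Longrightarrow> cube_adj N (g x) (g y)"
    and "x \<in> cube N" "y \<in> cube N"
  shows "hdist N (g x) (g y) \<le> hdist N x y"
  using assms(3,4)
proof (induction "hdist N x y" arbitrary: x)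
  case 0
  then have "x = y" by (intro cube_eqI) (auto simp: hdist_def)
  then show ?case by (simp add: hdist_def)
next
  case (Suc d)
  have "{i. i < N \<and> x i \<noteq> y i} \<noteq> {}"
  proof
    assume "{i. i < N \<and> x i \<noteq> y i} = {}"
    then show False using Suc.hyps(2) unfolding hdist_def by (simp only: card.empty)
  qed
  then obtain i where i: "i < N" "x i \<noteq> y i" by blast
  define x' where "x' = x(i := y i)"
  have x': "x' \<in> cube N" using Suc.prems i by (auto simp: x'_def cube_def PiE_iff extensional_def)
  have "{j. j < N \<and> x' j \<noteq> y j} = {j. j < N \<and> x j \<noteq> y j} - {i}"
    by (auto simp: x'_def)
  then have d: "d = hdist N x' y" using Suc.hyps(2) i by (simp add: hdist_def)
  have "{j. j < N \<and> x j \<noteq> x' j} = {i}" using i by (auto simp: x'_def)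
  then have "cube_adj N x x'" by (simp add: cube_adj_def)
  then have "hdist N (g x) (g x') = 1"
    using g(2)[OF Suc.prems(1) x'] by (simp add: cube_adj_def hdist_def)
  moreover have "hdist N (g x') (g y) \<le> d" using Suc.hyps(1)[OF d x' Suc.prems(2)] d by simp
  ultimately show ?case
    using hdist_triangle[of N "g x" "g y" "g x'"] Suc.hyps(2) by simp
qed

lemma cube_aut_hdist:
  assumes g: "g \<in> cube_aut N" and xy: "x \<in> cube N" "y \<in> cube N"
  shows "hdist N (g x) (g y) = hdist N x y"
proof (rule antisym)
  have b: "bij_betw g (cube N) (cube N)" using g by (auto simp: cube_aut_def Bij_def)
  have gx: "g x \<in> cube N" if "x \<in> cube N" for x using b that by (auto simp: bij_betw_def)
  show "hdist N (g x) (g y) \<le> hdist N x y"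
    using g by (intro cube_aut_hdist_le[of N g] gx xy) (auto simp: cube_aut_def)
  let ?h = "inv_into (cube N) g"
  have h: "?h a \<in> cube N" "g (?h a) = a" if "a \<in> cube N" for a
    using b that by (auto simp: bij_betw_def inv_into_into f_inv_into_f)
  have hg: "?h (g a) = a" if "a \<in> cube N" for a
    using b that by (simp add: bij_betw_inv_into_left)
  have "hdist N (?h (g x)) (?h (g y)) \<le> hdist N (g x) (g y)"
  proof (intro cube_aut_hdist_le[of N ?h] gx xy h)
    fix a b assume ab: "a \<in> cube N" "b \<in> cube N" "cube_adj N a b"
    then have "cube_adj N (g (?h a)) (g (?h b))" by (simp add: h)
    then show "cube_adj N (?h a) (?h b)" using g h(1) ab by (auto simp: cube_aut_def)
  qed
  then show "hdist N x y \<le> hdist N (g x) (g y)" by (simp add: hg xy)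
qed

definition pattern :: "vertex \<times> vertex \<times> vertex \<Rightarrow> nat \<Rightarrow> bool \<times> bool" where
  "pattern = (\<lambda>(x, y, z) i. (x i = y i, x i = z i))"

lemma profile_pattern:
  assumes "x \<in> cube N" "y \<in> cube N" "z \<in> cube N"
  shows "profile N (x, y, z) =
    (card {i. i < N \<and> pattern (x, y, z) i = (True, True)},
     card {i. i < N \<and> pattern (x, y, z) i = (False, False)},
     card {i. i < N \<and> pattern (x, y, z) i = (False, True)},
     card {i. i < N \<and> pattern (x, y, z) i = (True, False)})"
proof -
  have *: "(x i = 1 \<or> x i = -1) \<and> (y i = 1 \<or> y i = -1) \<and> (z i = 1 \<or> z i = -1)" if "i < N" for i
    using cube_val that assms by blast
  show ?thesis
    unfolding profile_def pattern_def
    by (auto intro!: arg_cong[where f = card] dest: *)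
qed

lemma profile_in_exps:
  assumes "x \<in> cube N" "y \<in> cube N" "z \<in> cube N"
  shows "profile N (x, y, z) \<in> exps N"
proof -
  define S where "S c = {i. i < N \<and> pattern (x, y, z) i = c}" for c
  have "card (\<Union>c\<in>UNIV. S c) = (\<Sum>c\<in>UNIV. card (S c))"
    by (rule card_UN_disjoint) (auto simp: S_def)
  moreover have "(\<Union>c\<in>UNIV. S c) = {..<N}" by (auto simp: S_def)
  ultimately have "N = (\<Sum>c\<in>UNIV. card (S c))" by simp
  also have "(UNIV :: (bool \<times> bool) set) = {(True, True), (False, False), (False, True), (True, False)}"
    by auto
  finally show ?thesis
    by (simp add: profile_pattern[OF assms] exps_def S_def)
qed

lemma profile_aut:
  assumes g: "g \<in> cube_aut N" and xyz: "x \<in> cube N" "y \<in> cube N" "z \<in> cube N"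
  shows "profile N (g x, g y, g z) = profile N (x, y, z)"
proof -
  have gx: "g x \<in> cube N" if "x \<in> cube N" for x
    using g that by (auto simp: cube_aut_def Bij_def bij_betw_def)
  have dist: "\<exists>r s t u. profile N (a, b, c) = (r, s, t, u) \<and> r + s + t + u = N \<and>
      hdist N a b = s + t \<and> hdist N b c = t + u \<and> hdist N a c = s + u"
    if abc: "a \<in> cube N" "b \<in> cube N" "c \<in> cube N" for a b c
  proof -
    let ?S = "{i. i < N \<and> a i \<noteq> b i \<and> b i = c i}"
    let ?T = "{i. i < N \<and> b i \<noteq> c i \<and> c i = a i}"
    let ?U = "{i. i < N \<and> c i \<noteq> a i \<and> a i = b i}"
    have *: "(a i = 1 \<or> a i = -1) \<and> (b i = 1 \<or> b i = -1) \<and> (c i = 1 \<or> c i = -1)" if "i < N" for i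
      using cube_val that abc by blast
    have "{i. i < N \<and> a i \<noteq> b i} = ?S \<union> ?T" "{i. i < N \<and> b i \<noteq> c i} = ?T \<union> ?U"
      "{i. i < N \<and> a i \<noteq> c i} = ?S \<union> ?U"
      by (auto dest: *)
    moreover have "card (?S \<union> ?T) = card ?S + card ?T" "card (?T \<union> ?U) = card ?T + card ?U"
      "card (?S \<union> ?U) = card ?S + card ?U"
      by (intro card_Un_disjoint; force)+
    ultimately show ?thesis
      using profile_in_exps[OF abc] by (auto simp: profile_def exps_def hdist_def)
  qed
  show ?thesis
    using dist[OF xyz] dist[OF gx[OF xyz(1)] gx[OF xyz(2)] gx[OF xyz(3)]]
      cube_aut_hdist[OF g xyz(1,2)] cube_aut_hdist[OF g xyz(2,3)] cube_aut_hdist[OF g xyz(1,3)]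
    by auto
qed

lemma cube_aut_monomial:
  assumes p: "bij_betw p {..<N} {..<N}" and e: "\<And>i. i < N \<Longrightarrow> e i = 1 \<or> e i = (-1::int)"
  shows "(\<lambda>a\<in>cube N. \<lambda>i\<in>{..<N}. e i * a (p i)) \<in> cube_aut N"
proof -
  let ?g = "\<lambda>a\<in>cube N. \<lambda>i\<in>{..<N}. e i * a (p i)"
  have pN: "p i < N" if "i < N" for i using p that by (auto simp: bij_betw_def)
  have gx: "?g a \<in> cube N" if a: "a \<in> cube N" for a
  proof -
    have "e i * a (p i) = 1 \<or> e i * a (p i) = -1" if "i < N" for i
      using e[OF that] cube_val[OF a pN[OF that]] by auto
    then show ?thesis using a by (auto simp: cube_def)
  qed
  have dist: "hdist N (?g a) (?g b) = hdist N a b" if ab: "a \<in> cube N" "b \<in> cube N" for a b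
  proof -
    have e0: "e i \<noteq> 0" if "i < N" for i using e[OF that] by auto
    have "bij_betw p {i. i < N \<and> ?g a i \<noteq> ?g b i} {i. i < N \<and> a i \<noteq> b i}"
    proof (rule bij_betw_subset[OF p])
      show "{i. i < N \<and> ?g a i \<noteq> ?g b i} \<subseteq> {..<N}" by auto
      have "j \<in> p ` {i. i < N \<and> ?g a i \<noteq> ?g b i}" if j: "j < N" "a j \<noteq> b j" for j
      proof -
        have "j \<in> p ` {..<N}" using p j by (simp add: bij_betw_def)
        then obtain i where "i < N" "p i = j" by auto
        then show ?thesis using j e0 ab by (intro image_eqI[of _ _ i]) auto
      qed
      then have "{i. i < N \<and> a i \<noteq> b i} \<subseteq> p ` {i. i < N \<and> ?g a i \<noteq> ?g b i}" by blast
      moreover have "p ` {i. i < N \<and> ?g a i \<noteq> ?g b i} \<subseteq> {i. i < N \<and> a i \<noteq> b i}"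
        using ab pN by auto
      ultimately show "p ` {i. i < N \<and> ?g a i \<noteq> ?g b i} = {i. i < N \<and> a i \<noteq> b i}" by simp
    qed
    then show ?thesis unfolding hdist_def by (rule bij_betw_same_card)
  qed
  have "inj_on ?g (cube N)"
  proof (rule inj_onI)
    fix a b assume ab: "a \<in> cube N" "b \<in> cube N" "?g a = ?g b"
    then have "hdist N a b = 0" using dist[OF ab(1,2)] by (simp add: hdist_def)
    then show "a = b" by (intro cube_eqI[OF ab(1,2)]) (auto simp: hdist_def)
  qed
  moreover from this have "?g ` cube N = cube N"
    using gx by (intro endo_inj_surj finite_cube) auto
  ultimately have "?g \<in> Bij (cube N)" by (simp add: Bij_def bij_betw_def)
  then show ?thesis
    using dist by (auto simp: cube_aut_def cube_adj_def hdist_def)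
qed

lemma profile_transitive:
  assumes x: "x \<in> cube N" "y \<in> cube N" "z \<in> cube N"
    and x': "x' \<in> cube N" "y' \<in> cube N" "z' \<in> cube N"
    and eq: "profile N (x, y, z) = profile N (x', y', z')"
  shows "\<exists>g\<in>cube_aut N. g x = x' \<and> g y = y' \<and> g z = z'"
proof -
  define S where "S c = {i. i < N \<and> pattern (x, y, z) i = c}" for c
  define S' where "S' c = {i. i < N \<and> pattern (x', y', z') i = c}" for c
  have "card (S' c) = card (S c)" for c
    using eq unfolding profile_pattern[OF x] profile_pattern[OF x'] S_def S'_def
    by (cases c; cases "fst c"; cases "snd c") auto
  then have "\<exists>p. bij_betw p (S' c) (S c)" for c
    by (intro finite_same_card_bij) (auto simp: S_def S'_def)
  then obtain P where P: "\<And>c. bij_betw (P c) (S' c) (S c)" by metis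
  define p where "p i = P (pattern (x', y', z') i) i" for i
  have pS: "bij_betw p (S' c) (S c)" for c
    using P[of c] by (rule bij_betw_cong[THEN iffD1, rotated]) (auto simp: p_def S'_def)
  have "bij_betw p (\<Union>c\<in>UNIV. S' c) (\<Union>c\<in>UNIV. S c)"
  proof (rule bij_betw_imageI)
    show "inj_on p (\<Union>c\<in>UNIV. S' c)"
    proof (rule inj_onI)
      fix i j assume ij: "i \<in> (\<Union>c\<in>UNIV. S' c)" "j \<in> (\<Union>c\<in>UNIV. S' c)" "p i = p j"
      then obtain c d where cd: "i \<in> S' c" "j \<in> S' d" by blast
      then have "p i \<in> S c" "p j \<in> S d" using bij_betwE[OF pS] by blast+
      then have "c = d" using ij(3) by (simp add: S_def)
      then show "i = j" using pS[of c] cd ij(3) by (auto simp: bij_betw_def inj_on_def)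
    qed
    show "p ` (\<Union>c\<in>UNIV. S' c) = (\<Union>c\<in>UNIV. S c)"
      using pS by (simp add: image_UN bij_betw_def)
  qed
  moreover have "(\<Union>c\<in>UNIV. S c) = {..<N}" "(\<Union>c\<in>UNIV. S' c) = {..<N}"
    by (auto simp: S_def S'_def)
  ultimately have pb: "bij_betw p {..<N} {..<N}" by simp
  have pN: "p i < N" if "i < N" for i using pb that by (auto simp: bij_betw_def)
  have pat: "pattern (x, y, z) (p i) = pattern (x', y', z') i" if "i < N" for i
  proof -
    have "i \<in> S' (pattern (x', y', z') i)" using that by (simp add: S'_def)
    then have "p i \<in> S (pattern (x', y', z') i)" using bij_betwE[OF pS] by blast
    then show ?thesis by (simp add: S_def)
  qed
  define e where "e i = x' i * x (p i)" for i
  have e: "e i = 1 \<or> e i = -1" if "i < N" for i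
    using cube_val[OF x'(1) that] cube_val[OF x(1) pN[OF that]] by (auto simp: e_def)
  let ?g = "\<lambda>a\<in>cube N. \<lambda>i\<in>{..<N}. e i * a (p i)"
  have g: "?g \<in> cube_aut N" by (rule cube_aut_monomial[OF pb e])
  then have gx: "?g a \<in> cube N" if "a \<in> cube N" for a
    using that unfolding cube_aut_def Bij_def bij_betw_def by blast
  have "?g x = x' \<and> ?g y = y' \<and> ?g z = z'"
  proof (intro conjI cube_eqI[of _ N] gx x x')
    fix i assume i: "i < N"
    have val: "e i * a (p i) = a' i"
      if "a \<in> cube N" "a' \<in> cube N" "x (p i) = a (p i) \<longleftrightarrow> x' i = a' i" for a a'
      using cube_val[OF x(1) pN[OF i]] cube_val[OF that(1) pN[OF i]]
        cube_val[OF x'(1) i] cube_val[OF that(2) i] that(3)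
      unfolding e_def by (elim disjE) simp_all
    have "x (p i) = y (p i) \<longleftrightarrow> x' i = y' i" "x (p i) = z (p i) \<longleftrightarrow> x' i = z' i"
      using pat[OF i] by (simp_all add: pattern_def)
    then show "?g x i = x' i" "?g y i = y' i" "?g z i = z' i"
      using val x x' i by (simp_all add: restrict_def)
  qed
  then show ?thesis using g by blast
qed

lemma profile_surj:
  assumes "m \<in> exps N"
  shows "\<exists>x\<in>cube N. \<exists>y\<in>cube N. \<exists>z\<in>cube N. profile N (x, y, z) = m"
proof -
  obtain r s t u where m: "m = (r, s, t, u)" and N: "r + s + t + u = N"
    using assms by (auto simp: exps_def)
  define x :: vertex where "x = (\<lambda>i\<in>{..<N}. if i < r then 1 else if i < r + s then -1 else 1)"
  define y :: vertex where "y = (\<lambda>i\<in>{..<N}. if i < r + s then 1 else if i < r + s + t then -1 else 1)"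
  define z :: vertex where "z = (\<lambda>i\<in>{..<N}. if i < r + s + t then 1 else -1)"
  have mem: "x \<in> cube N" "y \<in> cube N" "z \<in> cube N"
    by (auto simp: x_def y_def z_def cube_def)
  have "{i. i < N \<and> x i = y i \<and> y i = z i} = {..<r}"
    "{i. i < N \<and> x i \<noteq> y i \<and> y i = z i} = {r..<r + s}"
    "{i. i < N \<and> y i \<noteq> z i \<and> z i = x i} = {r + s..<r + s + t}"
    "{i. i < N \<and> z i \<noteq> x i \<and> x i = y i} = {r + s + t..<N}"
    using N by (auto simp: x_def y_def z_def split: if_splits)
  then have "profile N (x, y, z) = m" using N by (simp add: profile_def m)
  then show ?thesis using mem by blast
qed

lemma lookup_Bvec: "Poly_Mapping.lookup (Bvec N m) k =
    (if k \<in> cube N \<times> cube N \<times> cube N \<and> profile N k = m then 1 else 0)"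
proof -
  have "Bvec N m = (\<Sum>k\<in>{k \<in> cube N \<times> cube N \<times> cube N. profile N k = m}. Poly_Mapping.single k 1)"
    unfolding Bvec_def by (intro sum.cong) (auto simp: tensor3_single)
  then show ?thesis
    by (simp add: Poly_Mapping.lookup_sum Poly_Mapping.lookup_single when_def finite_cube)
qed

lemma fixG_iff: "v \<in> fixG N \<longleftrightarrow> v \<in> cubeV3 N \<and>
    (\<forall>g\<in>cube_aut N. \<forall>x\<in>cube N. \<forall>y\<in>cube N. \<forall>z\<in>cube N.
       Poly_Mapping.lookup v (g x, g y, g z) = Poly_Mapping.lookup v (x, y, z))"
proof -
  have "act3 g v = v \<longleftrightarrow> (\<forall>x\<in>cube N. \<forall>y\<in>cube N. \<forall>z\<in>cube N.
       Poly_Mapping.lookup v (g x, g y, g z) = Poly_Mapping.lookup v (x, y, z))"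
    if v: "v \<in> cubeV3 N" and g: "g \<in> cube_aut N" for g
  proof -
    let ?Y = "cube N \<times> cube N \<times> cube N"
    let ?h = "\<lambda>(x, y, z). (g x, g y, g z)"
    have b: "bij_betw g (cube N) (cube N)" using g by (auto simp: cube_aut_def Bij_def)
    have inj: "inj_on ?h ?Y" using b by (auto simp: bij_betw_def inj_on_def)
    have surj: "?h ` ?Y = ?Y"
    proof
      show "?h ` ?Y \<subseteq> ?Y" using b by (auto simp: bij_betw_def)
      then show "?Y \<subseteq> ?h ` ?Y"
        using endo_inj_surj[of ?Y ?h] inj finite_cube by auto
    qed
    have fin: "finite ?Y" using finite_cube by simp
    have eq: "act3 g v = (\<Sum>k\<in>?Y. Poly_Mapping.single (?h k) (Poly_Mapping.lookup v k))"
      unfolding act3_def using v by (intro act_superset fin) (simp add: cubeV3_def)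
    have look: "Poly_Mapping.lookup (act3 g v) (?h k) = Poly_Mapping.lookup v k" if k: "k \<in> ?Y" for k
    proof -
      have "Poly_Mapping.lookup (act3 g v) (?h k) =
          (\<Sum>j\<in>?Y. if j = k then Poly_Mapping.lookup v j else 0)"
        unfolding eq Poly_Mapping.lookup_sum Poly_Mapping.lookup_single when_def
        using k by (intro sum.cong refl if_cong) (use inj_onD[OF inj] in blast)+
      then show ?thesis using k fin by (simp add: sum.delta)
    qed
    have out: "Poly_Mapping.lookup (act3 g v) k = Poly_Mapping.lookup v k" if k: "k \<notin> ?Y" for k
    proof -
      have "k \<notin> Poly_Mapping.keys v" using v k by (auto simp: cubeV3_def)
      moreover have "Poly_Mapping.lookup (act3 g v) k = 0"
        unfolding eq Poly_Mapping.lookup_sum Poly_Mapping.lookup_single when_def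
      proof (intro sum.neutral ballI)
        fix j assume "j \<in> ?Y"
        then have "?h j \<noteq> k" using surj k by blast
        then show "(if ?h j = k then Poly_Mapping.lookup v j else 0) = 0" by simp
      qed
      ultimately show ?thesis by (simp add: Poly_Mapping.in_keys_iff)
    qed
    have "act3 g v = v \<longleftrightarrow> (\<forall>k\<in>?h ` ?Y. Poly_Mapping.lookup (act3 g v) k = Poly_Mapping.lookup v k)"
      unfolding surj using out by (metis poly_mapping_eqI)
    also have "\<dots> \<longleftrightarrow> (\<forall>k\<in>?Y. Poly_Mapping.lookup v (?h k) = Poly_Mapping.lookup v k)"
      using look by (simp only: ball_simps) (metis (no_types, lifting))
    finally show ?thesis by auto
  qed
  then show ?thesis unfolding fixG_def by auto
qed

lemma finite_exps: "finite (exps N)"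
proof (rule finite_subset)
  show "exps N \<subseteq> {..N} \<times> {..N} \<times> {..N} \<times> {..N}" by (auto simp: exps_def)
qed simp

theorem linear_iso_exists:
  "\<exists>ddag. linear_iso (homog N) (fixG N) ddag \<and>
     (\<forall>m\<in>exps N. ddag (monom4 m) =
        scale (complex_of_real (sqrt (fact N * 2 ^ N))) (Btilde N m))"
proof -
  define w where "w m = complex_of_real (sqrt (fact N * 2 ^ N)) * (fact4 m / (fact N * 2 ^ N))" for m
  have w0: "w m \<noteq> 0" for m by (cases m) (simp add: w_def fact4_def)
  define D where "D f = (\<Sum>m\<in>exps N. scale (Poly_Mapping.lookup f m)
      (scale (complex_of_real (sqrt (fact N * 2 ^ N))) (Btilde N m)))" for f
  let ?Y = "cube N \<times> cube N \<times> cube N"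
  have prof: "profile N k \<in> exps N" if "k \<in> ?Y" for k
    using that profile_in_exps by (cases k) auto
  have real: "\<exists>k. k \<in> ?Y \<and> profile N k = m" if m: "m \<in> exps N" for m
  proof -
    obtain x y z where "x \<in> cube N" "y \<in> cube N" "z \<in> cube N" "profile N (x, y, z) = m"
      using profile_surj[OF m] by (elim bexE)
    then show ?thesis by (intro exI[of _ "(x, y, z)"]) simp
  qed
  have look: "Poly_Mapping.lookup (D f) k =
      (if k \<in> ?Y then Poly_Mapping.lookup f (profile N k) * w (profile N k) else 0)" for f k
  proof -
    have "Poly_Mapping.lookup (D f) k = (\<Sum>m\<in>exps N. if k \<in> ?Y \<and> profile N k = m then
        Poly_Mapping.lookup f m * w m else 0)"
      unfolding D_def Poly_Mapping.lookup_sum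
      by (intro sum.cong refl) (simp add: Btilde_def lookup_Bvec w_def)
    then show ?thesis using prof[of k] finite_exps by (cases "k \<in> ?Y") (simp_all add: sum.delta)
  qed
  have "D f \<in> fixG N" for f
  proof -
    have "D f \<in> cubeV3 N"
      by (auto simp: cubeV3_def Poly_Mapping.in_keys_iff look split: if_splits)
    moreover have "g x \<in> cube N" if "g \<in> cube_aut N" "x \<in> cube N" for g x
      using that by (auto simp: cube_aut_def Bij_def bij_betw_def)
    ultimately show ?thesis by (simp add: fixG_iff look profile_aut)
  qed
  moreover have "inj_on D (homog N)"
  proof (rule inj_onI)
    fix f g assume fg: "f \<in> homog N" "g \<in> homog N" "D f = D g"
    show "f = g"
    proof (rule poly_mapping_eqI)
      fix m show "Poly_Mapping.lookup f m = Poly_Mapping.lookup g m"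
      proof (cases "m \<in> exps N")
        case True
        from real[OF this] obtain k where k: "k \<in> ?Y" "profile N k = m" by (elim exE conjE)
        have "Poly_Mapping.lookup (D f) k = Poly_Mapping.lookup (D g) k" using fg by simp
        then show ?thesis using k w0 by (simp add: look)
      next
        case False
        then have "m \<notin> Poly_Mapping.keys f" "m \<notin> Poly_Mapping.keys g"
          using fg by (auto simp: homog_def)
        then show ?thesis by (simp add: Poly_Mapping.in_keys_iff)
      qed
    qed
  qed
  moreover have "\<exists>f\<in>homog N. D f = v" if v: "v \<in> fixG N" for v
  proof -
    have "\<forall>m\<in>exps N. \<exists>k. k \<in> ?Y \<and> profile N k = m" using real by (intro ballI)
    from bchoice[OF this] obtain K where K: "\<And>m. m \<in> exps N \<Longrightarrow> K m \<in> ?Y \<and> profile N (K m) = m"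
      by blast
    define f where "f = (\<Sum>m\<in>exps N. Poly_Mapping.single m (Poly_Mapping.lookup v (K m) / w m))"
    have lf: "Poly_Mapping.lookup f m = (if m \<in> exps N then Poly_Mapping.lookup v (K m) / w m else 0)" for m
      unfolding f_def Poly_Mapping.lookup_sum using finite_exps
      by (simp add: Poly_Mapping.lookup_single when_def sum.delta)
    have "f \<in> homog N" by (auto simp: homog_def Poly_Mapping.in_keys_iff lf split: if_splits)
    moreover have "D f = v"
    proof (rule poly_mapping_eqI)
      fix k show "Poly_Mapping.lookup (D f) k = Poly_Mapping.lookup v k"
      proof (cases "k \<in> ?Y")
        case False
        then have "k \<notin> Poly_Mapping.keys v" using v by (auto simp: fixG_def cubeV3_def)
        then show ?thesis using False by (simp add: look Poly_Mapping.in_keys_iff)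
      next
        case True
        obtain x y z where k: "k = (x, y, z)" by (cases k)
        obtain x' y' z' where K': "K (profile N k) = (x', y', z')" by (cases "K (profile N k)")
        have mem: "x \<in> cube N" "y \<in> cube N" "z \<in> cube N" "x' \<in> cube N" "y' \<in> cube N" "z' \<in> cube N"
          "profile N (x, y, z) = profile N (x', y', z')"
          using True[unfolded k] K[OF prof[OF True], unfolded K', unfolded k] by simp_all
        then obtain g where g: "g \<in> cube_aut N" "g x = x'" "g y = y'" "g z = z'"
          using profile_transitive[OF mem] by blast
        have "Poly_Mapping.lookup v (g x, g y, g z) = Poly_Mapping.lookup v (x, y, z)"
          using v[unfolded fixG_iff, THEN conjunct2, rule_format, OF g(1) mem(1,2,3)] .
        then show ?thesis
          using True prof[OF True] w0 g K' by (simp add: look lf k)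
      qed
    qed
    ultimately show ?thesis by blast
  qed
  ultimately have "bij_betw D (homog N) (fixG N)" by (intro bij_betw_imageI) (assumption, blast)
  moreover have "D (f + g) = D f + D g" "D (scale c f) = scale c (D f)" for f g c
    by (rule poly_mapping_eqI, simp add: look Poly_Mapping.lookup_add algebra_simps)+
  moreover have "D (monom4 m) = scale (complex_of_real (sqrt (fact N * 2 ^ N))) (Btilde N m)"
    if "m \<in> exps N" for m
    by (rule poly_mapping_eqI)
      (simp add: look monom4_eq_single Poly_Mapping.lookup_single when_def Btilde_def lookup_Bvec w_def)
  ultimately show ?thesis unfolding linear_iso_def by (intro exI[of _ D]) simp
qed

end

theory Submission
  imports Defs "HOL-Combinatorics.Multiset_Permutations"
begin

text \<open>Both sides are diagonal in the monomial basis, so everything reduces to the squared norm of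
  \<open>B(r, s, t, u)\<close>, the number of triples with a given profile. Such a triple is determined by
  its first vertex and by the word of length \<open>N\<close> recording, at each coordinate, which of the
  other two vertices agree with the first one; the profile prescribes the letter counts of that
  word. Hence there are \<open>2 ^ N\<close> times a multinomial coefficient of them.\<close>

definition pattern_mset :: "exponent \<Rightarrow> (bool \<times> bool) multiset" where
  "pattern_mset = (\<lambda>(r, s, t, u). replicate_mset r (True, True) + replicate_mset s (False, False) +
     replicate_mset t (False, True) + replicate_mset u (True, False))"

text \<open>This is the multinomial coefficient. Cleared of denominators, it passes from the natural
  numbers to the complex values of \<open>fact4\<close> by a plain cast.\<close>

lemma card_permutations_pattern_mset:
  "of_nat (card (permutations_of_multiset (pattern_mset m))) * fact4 m = fact (size (pattern_mset m))"
proof -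
  obtain r s t u where m: "m = (r, s, t, u)" by (cases m)
  let ?M = "pattern_mset m"
  \<comment> \<open>A letter that does not occur contributes \<open>fact 0 = 1\<close>, so the
    product may run over all four letters even if some exponents vanish.\<close>
  have "(\<Prod>c\<in>set_mset ?M. fact (count ?M c)) = (\<Prod>c\<in>UNIV. fact (count ?M c) :: nat)"
    by (intro prod.mono_neutral_left) (auto simp: not_in_iff)
  also have "(UNIV :: (bool \<times> bool) set) = {(True, True), (False, False), (False, True), (True, False)}"
    by auto
  also have "(\<Prod>c\<in>\<dots>. fact (count ?M c)) = (fact r * fact s * fact t * fact u :: nat)"
    by (simp add: m pattern_mset_def mult.assoc)
  finally have "card (permutations_of_multiset ?M) * (fact r * fact s * fact t * fact u) = fact (size ?M)"
    using card_permutations_of_multiset_aux[of ?M] by simp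
  then have "of_nat (card (permutations_of_multiset ?M) * (fact r * fact s * fact t * fact u)) =
      (of_nat (fact (size ?M)) :: complex)"
    by (rule arg_cong)
  then show ?thesis by (simp add: m fact4_def)
qed

text \<open>Coordinates take only two values, so a letter tells which of \<open>x\<close>,
  \<open>y\<close>, \<open>z\<close>, if any, differs from the other two. By
  \<open>profile_pattern\<close> the four letter counts are therefore the entries of the
  profile.\<close>

lemma mset_pattern_iff_profile:
  assumes "x \<in> cube N" "y \<in> cube N" "z \<in> cube N"
  shows "mset (map (pattern (x, y, z)) [0..<N]) = pattern_mset m \<longleftrightarrow> profile N (x, y, z) = m"
proof -
  obtain r s t u where m: "m = (r, s, t, u)" by (cases m)
  have count: "count (mset (map f [0..<N])) c = card {i. i < N \<and> f i = c}" for f and c :: "bool \<times> bool"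
  proof -
    have "{i. i < length (map f [0..<N]) \<and> c = map f [0..<N] ! i} = {i. i < N \<and> f i = c}"
      by auto
    then show ?thesis
      by (simp add: count_list_eq_length_filter length_filter_conv_card count_mset del: mset_map)
  qed
  show ?thesis
    unfolding multiset_eq_iff count profile_pattern[OF assms]
    by (auto simp: m pattern_mset_def split_paired_all all_bool_eq)
qed

lemma card_cube: "card (cube N) = 2 ^ N"
  by (simp add: cube_def card_PiE numeral_2_eq_2)

text \<open>Given \<open>x\<close> and the word, each \<open>y i\<close> and \<open>z i\<close> is
  forced to be \<open>x i\<close> or \<open>- x i\<close>; conversely, every arrangement of the
  prescribed letters arises from some triple.\<close>

lemma bij_betw_profile_permutations:
  assumes m: "m \<in> exps N"
  shows "bij_betw (\<lambda>k. (fst k, map (pattern k) [0..<N]))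
    {k \<in> cube N \<times> cube N \<times> cube N. profile N k = m}
    (cube N \<times> permutations_of_multiset (pattern_mset m))"
    (is "bij_betw ?F ?K ?L")
proof (rule bij_betw_byWitness)
  \<comment> \<open>The inverse map: \<open>y\<close> and \<open>z\<close> are recovered from
    \<open>x\<close> by sign changes wherever the word records disagreement.\<close>
  define reflect :: "vertex \<Rightarrow> (nat \<Rightarrow> bool) \<Rightarrow> vertex" where
    "reflect x b = (\<lambda>i\<in>{..<N}. if b i then x i else - x i)" for x b
  let ?G = "\<lambda>(x, l). (x, reflect x (\<lambda>i. fst (l ! i)), reflect x (\<lambda>i. snd (l ! i)))"
  have reflect_cube: "reflect x b \<in> cube N" if "x \<in> cube N" for x b
  proof -
    have "x i = 1 \<or> x i = - 1" if "i < N" for i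
      using cube_val[OF \<open>x \<in> cube N\<close> that] .
    then show ?thesis by (auto simp: reflect_def cube_def PiE_iff)
  qed
  have reflect_eq: "reflect x b = y"
    if "x \<in> cube N" "y \<in> cube N" "\<And>i. i < N \<Longrightarrow> b i \<longleftrightarrow> x i = y i" for x y b
  proof (rule cube_eqI[of _ N])
    fix i assume i: "i < N"
    show "reflect x b i = y i"
      using cube_val[OF that(1) i] cube_val[OF that(2) i] that(3)[OF i] i by (auto simp: reflect_def)
  qed (use reflect_cube that in auto)
  have reflect_same: "x i = reflect x b i \<longleftrightarrow> b i" if "x \<in> cube N" "i < N" for x b i
    using cube_val[OF that] that by (auto simp: reflect_def)
  have FG: "?F (?G q) = q" and Gcube: "?G q \<in> cube N \<times> cube N \<times> cube N" if q: "q \<in> ?L" for q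
  proof -
    obtain x l where xl: "q = (x, l)" by (cases q)
    have x: "x \<in> cube N" and l: "mset l = pattern_mset m"
      using q by (auto simp: xl permutations_of_multiset_def)
    have "length l = size (pattern_mset m)" using l by (metis size_mset)
    \<comment> \<open>Only here does \<open>m \<in> exps N\<close> enter: the word must have exactly
      one letter per coordinate.\<close>
    then have "length l = N" using m by (auto simp: exps_def pattern_mset_def)
    then show "?F (?G q) = q"
      using reflect_same[OF x] by (auto intro!: nth_equalityI simp: xl pattern_def)
    show "?G q \<in> cube N \<times> cube N \<times> cube N"
      using reflect_cube x by (simp add: xl)
  qed
  show "\<forall>k\<in>?K. ?G (?F k) = k"
    by (auto intro!: reflect_eq simp: pattern_def)
  show "\<forall>q\<in>?L. ?F (?G q) = q" using FG by blast
  show "?F ` ?K \<subseteq> ?L"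
    by (auto simp: permutations_of_multiset_def mset_pattern_iff_profile simp del: mset_map)
  show "?G ` ?L \<subseteq> ?K"
  proof (rule image_subsetI)
    fix q assume q: "q \<in> ?L"
    obtain x y z where k: "?G q = (x, y, z)" by (cases "?G q")
    \<comment> \<open>The word of the reconstructed triple is the given one, so its letter counts,
      and hence the profile, need no new computation.\<close>
    have "(x, map (pattern (x, y, z)) [0..<N]) \<in> ?L"
      using FG[OF q] q unfolding k by simp
    then have "profile N (x, y, z) = m"
      using Gcube[OF q] mset_pattern_iff_profile[of x N y z m]
      by (simp add: k permutations_of_multiset_def del: mset_map)
    then show "?G q \<in> ?K" using Gcube[OF q] by (simp add: k)
  qed
qed

text \<open>The count is the squared norm of \<open>Bvec N m\<close>, a sum of that many distinct
  orthonormal basis vectors.\<close>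

lemma card_profile:
  assumes m: "m \<in> exps N"
  shows "of_nat (card {k \<in> cube N \<times> cube N \<times> cube N. profile N k = m}) * fact4 m = fact N * 2 ^ N"
proof -
  have "size (pattern_mset m) = N" using m by (auto simp: exps_def pattern_mset_def)
  then show ?thesis
    using card_permutations_pattern_mset[of m]
    by (simp add: bij_betw_same_card[OF bij_betw_profile_permutations[OF m]]
        card_cartesian_product card_cube mult.assoc mult.commute)
qed

lemma poly_mapping_eq_sum_single:
  assumes "finite A" "Poly_Mapping.keys f \<subseteq> A"
  shows "f = (\<Sum>a\<in>A. scale (Poly_Mapping.lookup f a) (Poly_Mapping.single a 1))"
proof (rule poly_mapping_eqI)
  fix k
  have "k \<notin> A \<Longrightarrow> Poly_Mapping.lookup f k = 0"
    using assms by (auto simp: Poly_Mapping.in_keys_iff)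
  then show "Poly_Mapping.lookup f k =
      Poly_Mapping.lookup (\<Sum>a\<in>A. scale (Poly_Mapping.lookup f a) (Poly_Mapping.single a 1)) k"
    using assms by (simp add: Poly_Mapping.lookup_sum Poly_Mapping.lookup_single when_def
        if_distrib cong: if_cong)
qed

text \<open>The values on monomials determine the map. Linearity is available only on
  \<open>homog N\<close>, so the induction over partial sums has to check membership there.\<close>

lemma linear_iso_homog_expand:
  assumes iso: "linear_iso (homog N) T F" and f: "f \<in> homog N"
  shows "F f = (\<Sum>m\<in>exps N. scale (Poly_Mapping.lookup f m) (F (monom4 m)))"
proof -
  interpret vector_space scale by (rule vector_space_scale)
  have sub: "subspace (homog N)" by (rule subspace_homog)
  have "F (\<Sum>m\<in>A. scale (c m) (monom4 m)) = (\<Sum>m\<in>A. scale (c m) (F (monom4 m)))"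
    if "finite A" "A \<subseteq> exps N" for A c
    using that
  proof (induction A)
    case empty
    have "F (scale 0 0) = scale 0 (F 0)"
      using iso subspace_0[OF sub] unfolding linear_iso_def by blast
    then show ?case by simp
  next
    case (insert a A)
    have mono: "monom4 m \<in> homog N" if "m \<in> insert a A" for m
      using that insert.prems by (auto simp: homog_def monom4_eq_single)
    have "scale (c a) (monom4 a) \<in> homog N" "(\<Sum>m\<in>A. scale (c m) (monom4 m)) \<in> homog N"
      by (intro subspace_sum[OF sub] subspace_scale[OF sub] mono; blast)+
    then show ?case
      using iso mono insert unfolding linear_iso_def by simp
  qed
  from this[OF finite_exps order_refl] show ?thesis
    using poly_mapping_eq_sum_single[OF finite_exps, of f N] f
    by (metis (no_types, lifting) homog_def mem_Collect_eq monom4_eq_single sum.cong)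
qed

theorem theorem17p28:
  fixes N :: nat
    and ddag :: "poly4 \<Rightarrow> (vertex \<times> vertex \<times> vertex \<Rightarrow>\<^sub>0 complex)"
  assumes iso: "linear_iso (homog N) (fixG N) ddag"
    and monomials: "\<And>r s t u. (r, s, t, u) \<in> exps N \<Longrightarrow>
      ddag (ind_x ^ r * ind_y ^ s * ind_z ^ t * ind_w ^ u) =
        scale (complex_of_real (sqrt (fact N * 2 ^ N))) (Btilde N (r, s, t, u))"
  shows "\<forall>f\<in>homog N. \<forall>g\<in>homog N. poly_form f g = tensor_form (ddag f) (ddag g)"
proof (intro ballI)
  fix f g assume f: "f \<in> homog N" and g: "g \<in> homog N"
  \<comment> \<open>The common coefficient in \<open>ddag (monom4 m)\<close> of all basis triples
    with profile \<open>m\<close>.\<close>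
  define w where "w m = complex_of_real (sqrt (fact N * 2 ^ N)) * (fact4 m / (fact N * 2 ^ N))" for m
  let ?Y = "cube N \<times> cube N \<times> cube N"
  have prof: "profile N k \<in> exps N" if "k \<in> ?Y" for k
    using that profile_in_exps by (cases k) auto
  have ddag_monom4: "ddag (monom4 m) = scale (complex_of_real (sqrt (fact N * 2 ^ N))) (Btilde N m)"
    if "m \<in> exps N" for m
    using monomials that by (cases m) (simp add: monom4_def)
  \<comment> \<open>Different profiles have disjoint supports, so a single monomial contributes at
    each triple.\<close>
  have look: "Poly_Mapping.lookup (ddag h) k =
      (if k \<in> ?Y then Poly_Mapping.lookup h (profile N k) * w (profile N k) else 0)"
    if "h \<in> homog N" for h k
  proof -
    have "Poly_Mapping.lookup (ddag h) k = (\<Sum>m\<in>exps N. if k \<in> ?Y \<and> profile N k = m then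
        Poly_Mapping.lookup h m * w m else 0)"
      unfolding linear_iso_homog_expand[OF iso that] Poly_Mapping.lookup_sum
      by (intro sum.cong refl) (simp add: ddag_monom4 Btilde_def lookup_Bvec w_def)
    then show ?thesis using prof[of k] finite_exps by (cases "k \<in> ?Y") (simp_all add: sum.delta)
  qed
  \<comment> \<open>The left side is the squared norm of \<open>ddag (monom4 m)\<close>. Here
    \<open>w m\<close> is real with square \<open>fact4 m * fact4 m / (fact N * 2 ^ N)\<close>, and
    the cardinality cancels all but one factor \<open>fact4 m\<close>.\<close>
  have weight: "of_nat (card {k \<in> ?Y. profile N k = m}) * (w m * cnj (w m)) = fact4 m"
    if m: "m \<in> exps N" for m
  proof -
    let ?n = "fact N * 2 ^ N :: complex"
    have "complex_of_real (sqrt (fact N * 2 ^ N)) * complex_of_real (sqrt (fact N * 2 ^ N)) = ?n"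
      unfolding of_real_mult[symmetric] by (subst real_sqrt_mult_self) simp
    moreover have "cnj (fact4 m) = fact4 m" by (cases m) (simp add: fact4_def)
    ultimately have "w m * cnj (w m) = ?n * (fact4 m / ?n * (fact4 m / ?n))"
      unfolding w_def by (simp add: algebra_simps)
    also have "\<dots> = fact4 m * fact4 m / ?n" by simp
    finally have "of_nat (card {k \<in> ?Y. profile N k = m}) * (w m * cnj (w m)) =
        (of_nat (card {k \<in> ?Y. profile N k = m}) * fact4 m) * fact4 m / ?n"
      by simp
    then show ?thesis unfolding card_profile[OF m] by simp
  qed
  define b where "b m = Poly_Mapping.lookup f m * cnj (Poly_Mapping.lookup g m)" for m
  have fin: "finite ?Y" by (simp add: finite_cube)
  have "tensor_form (ddag f) (ddag g) =
      (\<Sum>k\<in>?Y. Poly_Mapping.lookup (ddag f) k * cnj (Poly_Mapping.lookup (ddag g) k))"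
    unfolding tensor_form_def
    by (intro sum_keys_superset fin) (auto simp: Poly_Mapping.in_keys_iff look[OF f] split: if_splits)
  also have "\<dots> = (\<Sum>k\<in>?Y. b (profile N k) * (w (profile N k) * cnj (w (profile N k))))"
    by (intro sum.cong refl) (simp add: look f g b_def mult_ac)
  \<comment> \<open>The summand depends on \<open>k\<close> only through its profile, so summing
    over each fibre just multiplies by its cardinality.\<close>
  also have "\<dots> = (\<Sum>m\<in>exps N. \<Sum>k\<in>{k \<in> ?Y. profile N k = m}.
      b (profile N k) * (w (profile N k) * cnj (w (profile N k))))"
    using prof by (intro sum.group[symmetric] fin finite_exps) blast
  also have "\<dots> = (\<Sum>m\<in>exps N. b m * (of_nat (card {k \<in> ?Y. profile N k = m}) * (w m * cnj (w m))))"
    by (intro sum.cong refl) simp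
  also have "\<dots> = (\<Sum>m\<in>exps N. fact4 m * Poly_Mapping.lookup f m * cnj (Poly_Mapping.lookup g m))"
    by (intro sum.cong refl) (simp add: weight, simp add: b_def mult_ac)
  also have "\<dots> = poly_form f g"
    unfolding poly_form_def using f
    by (intro sum_keys_superset[symmetric] finite_exps) (auto simp: homog_def)
  finally show "poly_form f g = tensor_form (ddag f) (ddag g)" by (rule sym)
qed

end
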